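(* Let $\Gamma=(V,E)$ be an infinite weighted graph and let $\Omega\subset V$ be a finite, connected subset with at least two vertices. Then $\bar h(\Omega)\le 1-h(\Omega)$, and equality holds if $\Omega$ is bipartite.
   Context: $\Gamma=(V,E)$ is a locally finite, connected graph with infinitely many vertices, equipped with symmetric edge weights $\mu_{xy}=\mu_{yx}\ge 0$, where $\mu_{xy}>0$ iff $(x,y)\in E$; self-loops ($\mu_{xx}>0$) are allowed. Put $\mu(x)=\sum_{y\in V}\mu_{xy}$. For finite $U\subset V$: $\mathrm{vol}(U)=\sum_{x\in U}\mu(x)$, $|\partial U|=\sum_{x\in U}\sum_{y\notin U}\mu_{xy}$; for finite $V_1,V_2\subset V$: $|E(V_1,V_2)|=\sum_{x\in V_1}\sum_{y\in V_2}\mu_{xy}$. Cheeger constant: $h(\Omega)=\inf\{|\partial U|/\mathrm{vol}(U):\emptyset\neq U\subset\Omega,\ U\text{ finite}\}$. Dual Cheeger constant: $\bar h(\Omega)=\sup\left\{\frac{2|E(V_1,V_2)|}{\mathrm{vol}(V_1)+\mathrm{vol}(V_2)}\right\}$, supremum over pairs of disjoint nonempty finite subsets $V_1,V_2\subset\Omega$. $\Omega$ is connected (bipartite) if the induced subgraph of $\Gamma$ on $\Omega$ is connected (bipartite); a bipartite graph has no self-loops. *)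

theory Defs
  imports Complex_Main "Graph_Theory.Digraph_Component"
begin

text \<open>
  The underlying graph is a digraph without parallel arcs whose arc set is a symmetric relation, so
  an undirected edge between \<open>x \<noteq> y\<close> is the pair of arcs \<open>(x, y)\<close>, \<open>(y, x)\<close>; loops are allowed.
  \<open>Digraph_Component.connected\<close> is graph connectivity, qualified because the topological constant of
  the same name is also in scope.
\<close>

locale infinite_weighted_graph = pair_sym_digraph \<Gamma> for \<Gamma> :: "'a pair_pre_digraph" +
  fixes \<mu> :: "'a \<Rightarrow> 'a \<Rightarrow> real"
  assumes weight_sym: "\<lbrakk>x \<in> pverts \<Gamma>; y \<in> pverts \<Gamma>\<rbrakk> \<Longrightarrow> \<mu> x y = \<mu> y x"
    and weight_nonneg: "\<lbrakk>x \<in> pverts \<Gamma>; y \<in> pverts \<Gamma>\<rbrakk> \<Longrightarrow> \<mu> x y \<ge> 0"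
    and weight_pos_iff: "\<lbrakk>x \<in> pverts \<Gamma>; y \<in> pverts \<Gamma>\<rbrakk> \<Longrightarrow> \<mu> x y > 0 \<longleftrightarrow> (x, y) \<in> parcs \<Gamma>"
    and locally_finite: "x \<in> pverts \<Gamma> \<Longrightarrow> finite (parcs \<Gamma> `` {x})"
    and connected_graph: "Digraph_Component.connected \<Gamma>"
    and infinite_verts: "infinite (pverts \<Gamma>)"

text \<open>
  In the next definition and in \<open>boundary_weight\<close>, sums over all of \<open>V\<close>, respectively over \<open>V - U\<close>,
  are restricted to the finite set \<open>parcs \<Gamma> `` {x}\<close> of neighbours of \<open>x\<close>, since \<open>\<mu> x y = 0\<close> for all
  other vertices \<open>y\<close>.
\<close>

definition vertex_weight :: "'a pair_pre_digraph \<Rightarrow> ('a \<Rightarrow> 'a \<Rightarrow> real) \<Rightarrow> 'a \<Rightarrow> real" where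
  "vertex_weight \<Gamma> \<mu> x = (\<Sum>y \<in> parcs \<Gamma> `` {x}. \<mu> x y)"

definition vol :: "'a pair_pre_digraph \<Rightarrow> ('a \<Rightarrow> 'a \<Rightarrow> real) \<Rightarrow> 'a set \<Rightarrow> real" where
  "vol \<Gamma> \<mu> U = (\<Sum>x\<in>U. vertex_weight \<Gamma> \<mu> x)"

definition boundary_weight :: "'a pair_pre_digraph \<Rightarrow> ('a \<Rightarrow> 'a \<Rightarrow> real) \<Rightarrow> 'a set \<Rightarrow> real" where
  "boundary_weight \<Gamma> \<mu> U = (\<Sum>x\<in>U. \<Sum>y \<in> parcs \<Gamma> `` {x} - U. \<mu> x y)"

definition edge_weight :: "('a \<Rightarrow> 'a \<Rightarrow> real) \<Rightarrow> 'a set \<Rightarrow> 'a set \<Rightarrow> real" where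
  "edge_weight \<mu> V\<^sub>1 V\<^sub>2 = (\<Sum>x\<in>V\<^sub>1. \<Sum>y\<in>V\<^sub>2. \<mu> x y)"

text \<open>
  For \<open>\<Omega> \<subseteq> V\<close> all the quotients below lie in \<open>[0, 1]\<close>, so the real-valued \<open>Inf\<close> and \<open>Sup\<close> are the
  intended ones as soon as the sets are nonempty: \<open>\<Omega>\<close> needs one vertex for the Cheeger constant and
  two for the dual one.
\<close>

definition cheeger :: "'a pair_pre_digraph \<Rightarrow> ('a \<Rightarrow> 'a \<Rightarrow> real) \<Rightarrow> 'a set \<Rightarrow> real" where
  "cheeger \<Gamma> \<mu> \<Omega> =
     Inf {boundary_weight \<Gamma> \<mu> U / vol \<Gamma> \<mu> U | U. U \<noteq> {} \<and> U \<subseteq> \<Omega> \<and> finite U}"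

definition dual_cheeger :: "'a pair_pre_digraph \<Rightarrow> ('a \<Rightarrow> 'a \<Rightarrow> real) \<Rightarrow> 'a set \<Rightarrow> real" where
  "dual_cheeger \<Gamma> \<mu> \<Omega> =
     Sup {2 * edge_weight \<mu> V\<^sub>1 V\<^sub>2 / (vol \<Gamma> \<mu> V\<^sub>1 + vol \<Gamma> \<mu> V\<^sub>2) | V\<^sub>1 V\<^sub>2.
            V\<^sub>1 \<noteq> {} \<and> V\<^sub>2 \<noteq> {} \<and> finite V\<^sub>1 \<and> finite V\<^sub>2 \<and>
            V\<^sub>1 \<subseteq> \<Omega> \<and> V\<^sub>2 \<subseteq> \<Omega> \<and> V\<^sub>1 \<inter> V\<^sub>2 = {}}"

definition bipartite :: "('a, 'b) pre_digraph \<Rightarrow> bool" where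
  "bipartite G \<longleftrightarrow>
     (\<exists>A B. A \<union> B = verts G \<and> A \<inter> B = {} \<and>
        (\<forall>e \<in> arcs G. tail G e \<in> A \<and> head G e \<in> B \<or> tail G e \<in> B \<and> head G e \<in> A))"

end

theory Submission
  imports Defs
begin

text \<open>
  Splitting the weights at the vertices of a finite set \<open>U\<close> according to whether the other endpoint
  lies in \<open>U\<close> gives \<open>vol(U) = |\<partial>U| + |E(U, U)|\<close>. If \<open>U\<close> is the disjoint union of \<open>P\<close> and \<open>Q\<close>, then
  \<open>|E(U, U)| = |E(P, P)| + |E(Q, Q)| + 2 |E(P, Q)|\<close>, so that, after division by \<open>vol(U)\<close>,
  \<open>2 |E(P, Q)| / (vol(P) + vol(Q)) = 1 - |\<partial>U| / vol(U) - (|E(P, P)| + |E(Q, Q)|) / vol(U)\<close>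
  (lemma \<open>dual_quotient_eq\<close>). The last term is nonnegative, which bounds every quotient in the
  supremum \<open>dual_cheeger\<close> by \<open>1 - cheeger\<close>.

  In the bipartite case every \<open>U \<subseteq> \<Omega>\<close> splits along the bipartition into \<open>P\<close> and \<open>Q\<close> for which the
  last term vanishes, so \<open>1 - |\<partial>U| / vol(U)\<close> is itself one of the quotients, provided that \<open>P\<close> and
  \<open>Q\<close> are both nonempty. Otherwise \<open>E(U, U) = 0\<close>, so \<open>|\<partial>U| = vol(U) > 0\<close> and there is nothing to
  show beyond \<open>dual_cheeger \<ge> 0\<close>. Hence the infimum \<open>cheeger\<close> is at least \<open>1 - dual_cheeger\<close>.
\<close>

section \<open>Disjoint unions\<close>

lemma edge_weight_Un_left:
  assumes "finite A" "finite B" "A \<inter> B = {}"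
  shows "edge_weight \<mu> (A \<union> B) C = edge_weight \<mu> A C + edge_weight \<mu> B C"
  using assms by (simp add: edge_weight_def sum.union_disjoint)

lemma edge_weight_Un_right:
  assumes "finite A" "finite B" "A \<inter> B = {}"
  shows "edge_weight \<mu> C (A \<union> B) = edge_weight \<mu> C A + edge_weight \<mu> C B"
  using assms by (simp add: edge_weight_def sum.union_disjoint sum.distrib)

lemma vol_Un:
  assumes "finite A" "finite B" "A \<inter> B = {}"
  shows "vol \<Gamma> \<mu> (A \<union> B) = vol \<Gamma> \<mu> A + vol \<Gamma> \<mu> B"
  using assms by (simp add: vol_def sum.union_disjoint)

lemma two_elements:
  assumes "card \<Omega> \<ge> 2"
  obtains x y where "x \<in> \<Omega>" "y \<in> \<Omega>" "x \<noteq> y"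
  using assms by (auto simp: numeral_2_eq_2 card_le_Suc_iff)

context infinite_weighted_graph
begin

section \<open>Positivity of volumes\<close>

lemma weight_eq_0:
  assumes "x \<in> pverts \<Gamma>" "y \<in> pverts \<Gamma>" "(x, y) \<notin> parcs \<Gamma>"
  shows "\<mu> x y = 0"
  using weight_nonneg[of x y] weight_pos_iff[of x y] assms by force

lemma neighbour_in_pverts: "(x, y) \<in> parcs \<Gamma> \<Longrightarrow> y \<in> pverts \<Gamma>"
  using in_arcsD2 by blast

text \<open>
  Since the graph is infinite there is another vertex to walk to, and the first step of such a walk
  leads to a neighbour.
\<close>

lemma ex_neighbour:
  assumes "x \<in> pverts \<Gamma>"
  obtains y where "(x, y) \<in> parcs \<Gamma>"
proof -
  have "strongly_connected \<Gamma>"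
    using connected_graph sym_arcs by (intro symmetric_connected_imp_strongly_connected)
  moreover obtain z where "z \<in> pverts \<Gamma>" "z \<noteq> x"
    using infinite_imp_nonempty[OF infinite_remove[OF infinite_verts, of x]] by auto
  ultimately have "x \<rightarrow>\<^sup>*\<^bsub>\<Gamma>\<^esub> z"
    using assms by (auto simp: strongly_connected_def)
  then show ?thesis
    using \<open>z \<noteq> x\<close> that by (cases rule: converse_reachable_cases) auto
qed

lemma vertex_weight_pos:
  assumes "x \<in> pverts \<Gamma>"
  shows "vertex_weight \<Gamma> \<mu> x > 0"
proof -
  obtain y where y: "(x, y) \<in> parcs \<Gamma>"
    using ex_neighbour[OF assms] .
  have "\<mu> x z > 0" if "z \<in> parcs \<Gamma> `` {x}" for z
    using that weight_pos_iff assms neighbour_in_pverts by auto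
  then show ?thesis
    unfolding vertex_weight_def using locally_finite[OF assms] y by (intro sum_pos) auto
qed

lemma vol_pos:
  assumes "finite U" "U \<noteq> {}" "U \<subseteq> pverts \<Gamma>"
  shows "vol \<Gamma> \<mu> U > 0"
  unfolding vol_def using assms vertex_weight_pos by (intro sum_pos) auto

lemma boundary_weight_nonneg:
  assumes "U \<subseteq> pverts \<Gamma>"
  shows "boundary_weight \<Gamma> \<mu> U \<ge> 0"
  unfolding boundary_weight_def
  using assms neighbour_in_pverts by (intro sum_nonneg weight_nonneg) auto

lemma edge_weight_nonneg:
  assumes "A \<subseteq> pverts \<Gamma>" "B \<subseteq> pverts \<Gamma>"
  shows "edge_weight \<mu> A B \<ge> 0"
  unfolding edge_weight_def using assms by (intro sum_nonneg weight_nonneg) auto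

lemma edge_weight_commute:
  assumes "A \<subseteq> pverts \<Gamma>" "B \<subseteq> pverts \<Gamma>"
  shows "edge_weight \<mu> A B = edge_weight \<mu> B A"
proof -
  have "edge_weight \<mu> A B = (\<Sum>y\<in>B. \<Sum>x\<in>A. \<mu> x y)"
    unfolding edge_weight_def by (rule sum.swap)
  also have "\<dots> = edge_weight \<mu> B A"
    unfolding edge_weight_def using assms weight_sym by (intro sum.cong) auto
  finally show ?thesis .
qed

section \<open>The quotients of the two constants compared\<close>

text \<open>
  Both sides collect the weights at the vertices of \<open>U\<close>. The boundary term keeps the neighbours
  outside \<open>U\<close>; the inner term runs over all of \<open>U\<close>, where vertices that are not neighbours
  contribute weight \<open>0\<close>.
\<close>

lemma vol_eq_boundary_plus_inner:
  assumes "finite U" "U \<subseteq> pverts \<Gamma>"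
  shows "vol \<Gamma> \<mu> U = boundary_weight \<Gamma> \<mu> U + edge_weight \<mu> U U"
proof -
  have "vertex_weight \<Gamma> \<mu> x = (\<Sum>y \<in> parcs \<Gamma> `` {x} - U. \<mu> x y) + (\<Sum>y\<in>U. \<mu> x y)"
    if "x \<in> U" for x
  proof -
    have x: "x \<in> pverts \<Gamma>"
      using that assms by auto
    have "vertex_weight \<Gamma> \<mu> x =
        (\<Sum>y \<in> parcs \<Gamma> `` {x} \<inter> U. \<mu> x y) + (\<Sum>y \<in> parcs \<Gamma> `` {x} - U. \<mu> x y)"
      unfolding vertex_weight_def using locally_finite[OF x] by (rule sum.Int_Diff)
    moreover have "(\<Sum>y \<in> parcs \<Gamma> `` {x} \<inter> U. \<mu> x y) = (\<Sum>y\<in>U. \<mu> x y)"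
      using assms x by (intro sum.mono_neutral_left) (auto intro: weight_eq_0)
    ultimately show ?thesis by simp
  qed
  then show ?thesis
    by (simp add: vol_def boundary_weight_def edge_weight_def sum.distrib)
qed

text \<open>
  Edges between \<open>P\<close> and \<open>Q\<close> are counted twice in \<open>|E(U, U)|\<close> for \<open>U = P \<union> Q\<close>, once from either
  end; this is the reason for the factor \<open>2\<close> in the dual Cheeger constant.
\<close>

lemma dual_quotient_eq:
  assumes "finite P" "finite Q" "P \<subseteq> pverts \<Gamma>" "Q \<subseteq> pverts \<Gamma>" "P \<inter> Q = {}" "P \<union> Q \<noteq> {}"
  shows "2 * edge_weight \<mu> P Q / (vol \<Gamma> \<mu> P + vol \<Gamma> \<mu> Q) =
    1 - boundary_weight \<Gamma> \<mu> (P \<union> Q) / vol \<Gamma> \<mu> (P \<union> Q)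
      - (edge_weight \<mu> P P + edge_weight \<mu> Q Q) / vol \<Gamma> \<mu> (P \<union> Q)"
proof -
  have "vol \<Gamma> \<mu> (P \<union> Q) = boundary_weight \<Gamma> \<mu> (P \<union> Q) + edge_weight \<mu> (P \<union> Q) (P \<union> Q)"
    using assms by (intro vol_eq_boundary_plus_inner) auto
  also have "edge_weight \<mu> (P \<union> Q) (P \<union> Q) =
      edge_weight \<mu> P P + edge_weight \<mu> Q Q + 2 * edge_weight \<mu> P Q"
    using assms edge_weight_commute[of P Q]
    by (simp add: edge_weight_Un_left edge_weight_Un_right)
  finally have split: "vol \<Gamma> \<mu> (P \<union> Q) = boundary_weight \<Gamma> \<mu> (P \<union> Q)
      + (edge_weight \<mu> P P + edge_weight \<mu> Q Q + 2 * edge_weight \<mu> P Q)" .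
  have pos: "vol \<Gamma> \<mu> (P \<union> Q) > 0"
    using assms by (intro vol_pos) auto
  have "2 * edge_weight \<mu> P Q = vol \<Gamma> \<mu> (P \<union> Q) - boundary_weight \<Gamma> \<mu> (P \<union> Q)
      - (edge_weight \<mu> P P + edge_weight \<mu> Q Q)"
    using split by linarith
  then have "2 * edge_weight \<mu> P Q / vol \<Gamma> \<mu> (P \<union> Q) =
    1 - boundary_weight \<Gamma> \<mu> (P \<union> Q) / vol \<Gamma> \<mu> (P \<union> Q)
      - (edge_weight \<mu> P P + edge_weight \<mu> Q Q) / vol \<Gamma> \<mu> (P \<union> Q)"
    using pos by (simp only: diff_divide_distrib) simp
  then show ?thesis
    using assms by (simp add: vol_Un)
qed

lemma dual_quotient_le:
  assumes "finite P" "finite Q" "P \<subseteq> pverts \<Gamma>" "Q \<subseteq> pverts \<Gamma>" "P \<inter> Q = {}" "P \<union> Q \<noteq> {}"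
  shows "2 * edge_weight \<mu> P Q / (vol \<Gamma> \<mu> P + vol \<Gamma> \<mu> Q) \<le>
    1 - boundary_weight \<Gamma> \<mu> (P \<union> Q) / vol \<Gamma> \<mu> (P \<union> Q)"
proof -
  have "vol \<Gamma> \<mu> (P \<union> Q) > 0"
    using assms by (intro vol_pos) auto
  then have "(edge_weight \<mu> P P + edge_weight \<mu> Q Q) / vol \<Gamma> \<mu> (P \<union> Q) \<ge> 0"
    using assms by (simp add: edge_weight_nonneg)
  then show ?thesis
    using dual_quotient_eq[OF assms] by linarith
qed

lemma boundary_quotient_nonneg:
  assumes "finite U" "U \<noteq> {}" "U \<subseteq> pverts \<Gamma>"
  shows "boundary_weight \<Gamma> \<mu> U / vol \<Gamma> \<mu> U \<ge> 0"
  using vol_pos[OF assms] boundary_weight_nonneg[OF assms(3)] by simp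

section \<open>The two constants compared\<close>

lemma cheeger_le:
  assumes "\<Omega> \<subseteq> pverts \<Gamma>" "U \<noteq> {}" "U \<subseteq> \<Omega>" "finite U"
  shows "cheeger \<Gamma> \<mu> \<Omega> \<le> boundary_weight \<Gamma> \<mu> U / vol \<Gamma> \<mu> U"
  unfolding cheeger_def
proof (rule cInf_lower)
  show "bdd_below {boundary_weight \<Gamma> \<mu> U / vol \<Gamma> \<mu> U | U. U \<noteq> {} \<and> U \<subseteq> \<Omega> \<and> finite U}"
    using assms(1) by (intro bdd_belowI[of _ 0]) (auto intro!: boundary_quotient_nonneg)
qed (use assms in auto)

text \<open>
  The upper bound that makes \<open>Sup\<close> meaningful, namely \<open>1\<close>, comes from the comparison of quotients.
\<close>

lemma le_dual_cheeger:
  assumes "\<Omega> \<subseteq> pverts \<Gamma>" "P \<noteq> {}" "Q \<noteq> {}" "finite P" "finite Q" "P \<subseteq> \<Omega>" "Q \<subseteq> \<Omega>" "P \<inter> Q = {}"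
  shows "2 * edge_weight \<mu> P Q / (vol \<Gamma> \<mu> P + vol \<Gamma> \<mu> Q) \<le> dual_cheeger \<Gamma> \<mu> \<Omega>"
  unfolding dual_cheeger_def
proof (rule cSup_upper)
  show "bdd_above {2 * edge_weight \<mu> V\<^sub>1 V\<^sub>2 / (vol \<Gamma> \<mu> V\<^sub>1 + vol \<Gamma> \<mu> V\<^sub>2) | V\<^sub>1 V\<^sub>2.
      V\<^sub>1 \<noteq> {} \<and> V\<^sub>2 \<noteq> {} \<and> finite V\<^sub>1 \<and> finite V\<^sub>2 \<and> V\<^sub>1 \<subseteq> \<Omega> \<and> V\<^sub>2 \<subseteq> \<Omega> \<and> V\<^sub>1 \<inter> V\<^sub>2 = {}}"
  proof (rule bdd_aboveI[of _ 1], clarify)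
    fix A B
    assume AB: "A \<noteq> {}" "finite A" "finite B" "A \<subseteq> \<Omega>" "B \<subseteq> \<Omega>" "A \<inter> B = {}"
    then have "2 * edge_weight \<mu> A B / (vol \<Gamma> \<mu> A + vol \<Gamma> \<mu> B) \<le>
        1 - boundary_weight \<Gamma> \<mu> (A \<union> B) / vol \<Gamma> \<mu> (A \<union> B)"
      using assms(1) by (intro dual_quotient_le) auto
    moreover have "boundary_weight \<Gamma> \<mu> (A \<union> B) / vol \<Gamma> \<mu> (A \<union> B) \<ge> 0"
      using assms(1) AB by (intro boundary_quotient_nonneg) auto
    ultimately show "2 * edge_weight \<mu> A B / (vol \<Gamma> \<mu> A + vol \<Gamma> \<mu> B) \<le> 1"
      by linarith
  qed
qed (use assms in blast)

text \<open>Two distinct vertices form a pair of singletons, whose quotient is nonnegative.\<close>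

lemma dual_cheeger_nonneg:
  assumes "\<Omega> \<subseteq> pverts \<Gamma>" "card \<Omega> \<ge> 2"
  shows "dual_cheeger \<Gamma> \<mu> \<Omega> \<ge> 0"
proof -
  obtain x y where xy: "x \<in> \<Omega>" "y \<in> \<Omega>" "x \<noteq> y"
    using two_elements assms(2) .
  then have "2 * edge_weight \<mu> {x} {y} / (vol \<Gamma> \<mu> {x} + vol \<Gamma> \<mu> {y}) \<le> dual_cheeger \<Gamma> \<mu> \<Omega>"
    using assms(1) by (intro le_dual_cheeger) auto
  moreover have "2 * edge_weight \<mu> {x} {y} / (vol \<Gamma> \<mu> {x} + vol \<Gamma> \<mu> {y}) \<ge> 0"
    using xy assms(1)
    by (intro divide_nonneg_pos add_pos_pos vol_pos mult_nonneg_nonneg edge_weight_nonneg) auto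
  ultimately show ?thesis by linarith
qed

lemma dual_cheeger_le:
  assumes "\<Omega> \<subseteq> pverts \<Gamma>" "card \<Omega> \<ge> 2"
  shows "dual_cheeger \<Gamma> \<mu> \<Omega> \<le> 1 - cheeger \<Gamma> \<mu> \<Omega>"
  unfolding dual_cheeger_def
proof (rule cSup_least, goal_cases)
  case 1
  obtain x y where "x \<in> \<Omega>" "y \<in> \<Omega>" "x \<noteq> y"
    using two_elements assms(2) .
  then have "\<exists>P Q. P \<noteq> {} \<and> Q \<noteq> {} \<and> finite P \<and> finite Q \<and> P \<subseteq> \<Omega> \<and> Q \<subseteq> \<Omega> \<and> P \<inter> Q = {}"
    by (intro exI[of _ "{x}"] exI[of _ "{y}"]) auto
  then show ?case by blast
next
  case (2 q)
  then obtain P Q where q: "q = 2 * edge_weight \<mu> P Q / (vol \<Gamma> \<mu> P + vol \<Gamma> \<mu> Q)"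
    and PQ: "P \<noteq> {}" "finite P" "finite Q" "P \<subseteq> \<Omega>" "Q \<subseteq> \<Omega>" "P \<inter> Q = {}"
    by blast
  have "q \<le> 1 - boundary_weight \<Gamma> \<mu> (P \<union> Q) / vol \<Gamma> \<mu> (P \<union> Q)"
    unfolding q using PQ assms(1) by (intro dual_quotient_le) auto
  moreover have "cheeger \<Gamma> \<mu> \<Omega> \<le> boundary_weight \<Gamma> \<mu> (P \<union> Q) / vol \<Gamma> \<mu> (P \<union> Q)"
    using PQ assms(1) by (intro cheeger_le) auto
  ultimately show ?case by linarith
qed

section \<open>Equality for bipartite sets\<close>

text \<open>
  An arc of the induced graph leads from one side of the bipartition to the other, and this also
  rules out loops; so the diagonal terms \<open>\<mu> x x\<close> of the inner weight vanish as well.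
\<close>

lemma bipartite_inducedE:
  assumes "bipartite (\<Gamma> \<restriction> \<Omega>)" "\<Omega> \<subseteq> pverts \<Gamma>"
  obtains A B where "A \<union> B = \<Omega>" "A \<inter> B = {}"
    "\<And>P. P \<subseteq> A \<Longrightarrow> edge_weight \<mu> P P = 0" "\<And>Q. Q \<subseteq> B \<Longrightarrow> edge_weight \<mu> Q Q = 0"
proof -
  obtain A B where AB: "A \<union> B = \<Omega>" "A \<inter> B = {}"
    and arcs_AB: "\<forall>e \<in> arcs (\<Gamma> \<restriction> \<Omega>). fst e \<in> A \<and> snd e \<in> B \<or> fst e \<in> B \<and> snd e \<in> A"
    using assms(1) by (auto simp: bipartite_def)
  have arcs: "x \<in> A \<and> y \<in> B \<or> x \<in> B \<and> y \<in> A"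
    if "(x, y) \<in> parcs \<Gamma>" "x \<in> \<Omega>" "y \<in> \<Omega>" for x y
    using arcs_AB[rule_format, of "(x, y)"] that by simp
  have no_inner: "edge_weight \<mu> P P = 0" if "P \<subseteq> A \<or> P \<subseteq> B" for P
    unfolding edge_weight_def
  proof (intro sum.neutral ballI)
    fix x y assume "x \<in> P" "y \<in> P"
    then show "\<mu> x y = 0"
      using that AB arcs[of x y] assms(2) by (intro weight_eq_0) auto
  qed
  show thesis
    using that[OF AB] no_inner by blast
qed

text \<open>
  The sets \<open>U\<close> in the Cheeger constant may lie on one side of the bipartition, whereas both members
  of a pair in the dual constant are nonempty. For such \<open>U\<close> no weight lies inside \<open>U\<close>, and the left
  hand side is \<open>0\<close>.
\<close>

lemma one_minus_boundary_quotient_le_dual_cheeger: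
  assumes "bipartite (\<Gamma> \<restriction> \<Omega>)" "\<Omega> \<subseteq> pverts \<Gamma>" "card \<Omega> \<ge> 2" "U \<noteq> {}" "U \<subseteq> \<Omega>" "finite U"
  shows "1 - boundary_weight \<Gamma> \<mu> U / vol \<Gamma> \<mu> U \<le> dual_cheeger \<Gamma> \<mu> \<Omega>"
proof -
  obtain A B where AB: "A \<union> B = \<Omega>" "A \<inter> B = {}"
    and no_inner: "\<And>P. P \<subseteq> A \<Longrightarrow> edge_weight \<mu> P P = 0" "\<And>Q. Q \<subseteq> B \<Longrightarrow> edge_weight \<mu> Q Q = 0"
    using bipartite_inducedE[OF assms(1,2)] by blast
  define P Q where "P = U \<inter> A" and "Q = U \<inter> B"
  have U: "P \<union> Q = U" "P \<inter> Q = {}"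
    using AB assms(5) by (auto simp: P_def Q_def)
  have "edge_weight \<mu> P P = 0" "edge_weight \<mu> Q Q = 0"
    using no_inner by (simp_all add: P_def Q_def)
  moreover have "2 * edge_weight \<mu> P Q / (vol \<Gamma> \<mu> P + vol \<Gamma> \<mu> Q) =
    1 - boundary_weight \<Gamma> \<mu> (P \<union> Q) / vol \<Gamma> \<mu> (P \<union> Q)
      - (edge_weight \<mu> P P + edge_weight \<mu> Q Q) / vol \<Gamma> \<mu> (P \<union> Q)"
    using assms U by (intro dual_quotient_eq) auto
  ultimately have quotient: "1 - boundary_weight \<Gamma> \<mu> U / vol \<Gamma> \<mu> U =
      2 * edge_weight \<mu> P Q / (vol \<Gamma> \<mu> P + vol \<Gamma> \<mu> Q)"
    by (simp add: U)
  show ?thesis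
  proof (cases "P = {} \<or> Q = {}")
    case True
    then have "edge_weight \<mu> P Q = 0"
      by (auto simp: edge_weight_def)
    then show ?thesis
      using quotient dual_cheeger_nonneg[OF assms(2,3)] by simp
  next
    case False
    then show ?thesis
      unfolding quotient using assms U by (intro le_dual_cheeger) auto
  qed
qed

lemma dual_cheeger_eq_if_bipartite:
  assumes "bipartite (\<Gamma> \<restriction> \<Omega>)" "\<Omega> \<subseteq> pverts \<Gamma>" "card \<Omega> \<ge> 2"
  shows "dual_cheeger \<Gamma> \<mu> \<Omega> = 1 - cheeger \<Gamma> \<mu> \<Omega>"
proof -
  have "1 - dual_cheeger \<Gamma> \<mu> \<Omega> \<le> cheeger \<Gamma> \<mu> \<Omega>"
    unfolding cheeger_def
  proof (rule cInf_greatest, goal_cases)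
    case 1
    have "\<Omega> \<noteq> {} \<and> \<Omega> \<subseteq> \<Omega> \<and> finite \<Omega>"
      using assms(3) by (auto intro: card_ge_0_finite)
    then show ?case by blast
  next
    case (2 r)
    then obtain U where "r = boundary_weight \<Gamma> \<mu> U / vol \<Gamma> \<mu> U" "U \<noteq> {}" "U \<subseteq> \<Omega>" "finite U"
      by blast
    then show ?case
      using one_minus_boundary_quotient_le_dual_cheeger[OF assms, of U] by linarith
  qed
  then show ?thesis
    using dual_cheeger_le[OF assms(2,3)] by linarith
qed

end

theorem theorem4p1:
  fixes \<Gamma> :: "'a pair_pre_digraph" and \<mu> :: "'a \<Rightarrow> 'a \<Rightarrow> real" and \<Omega> :: "'a set"
  assumes "infinite_weighted_graph \<Gamma> \<mu>"
    and "\<Omega> \<subseteq> pverts \<Gamma>" and "finite \<Omega>" and "card \<Omega> \<ge> 2"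
    and "Digraph_Component.connected (\<Gamma> \<restriction> \<Omega>)"
  shows "dual_cheeger \<Gamma> \<mu> \<Omega> \<le> 1 - cheeger \<Gamma> \<mu> \<Omega> \<and>
    (bipartite (\<Gamma> \<restriction> \<Omega>) \<longrightarrow> dual_cheeger \<Gamma> \<mu> \<Omega> = 1 - cheeger \<Gamma> \<mu> \<Omega>)"
proof -
  interpret infinite_weighted_graph \<Gamma> \<mu>
    by fact
  show ?thesis
    using dual_cheeger_le dual_cheeger_eq_if_bipartite assms(2,4) by blast
qed

end
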